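(* Let $m\in(0,1)$, $h_0,h_1\in\mathbb{R}$, and let $(P_t)_{t\ge0}$ be the residual polynomials of $\mathrm{HB}_2(h_0,h_1;m)$, i.e. the polynomials with $x_t-x_*=P_t(H)(x_0-x_* )$ for every quadratic $f(x)=\tfrac12(x-x_* )^\top H(x-x_* )+f_*$ and every $x_0$. Let $\zeta(\lambda)=\left(\frac{1+m-\lambda h_0}{2\sqrt m}\right)\left(\frac{1+m-\lambda h_1}{2\sqrt m}\right)$. Then for every $n\ge0$ and every $\lambda$ with $\zeta(\lambda)\ge0$ (in particular whenever $2\zeta(\lambda)-1\ge-1$), $$P_{2n}(\lambda)=m^n\left[\frac{2m}{1+m}T_{2n}\big(\sqrt{\zeta(\lambda)}\big)+\frac{1-m}{1+m}U_{2n}\big(\sqrt{\zeta(\lambda)}\big)\right].$$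
   Context: $\mathrm{HB}_2(h_0,h_1;m)$ started at $x_0$ produces $x_1=x_0-\frac{h_0}{1+m}\nabla f(x_0)$ and $x_{t+1}=x_t-h_{t\bmod 2}\nabla f(x_t)+m(x_t-x_{t-1})$ for $t\ge1$. $T_n$ and $U_n$ are the Chebyshev polynomials of the first and second kind ($T_0=U_0=1$, $T_1(x)=x$, $U_1(x)=2x$, both satisfying $Q_{n+1}=2xQ_n-Q_{n-1}$). *)

theory Defs
  imports "HOL-Analysis.Analysis" "HOL-Computational_Algebra.Polynomial"
begin

text \<open>Chebyshev polynomials of the first and second kind, as functions on the reals.\<close>
fun cheb_T :: "nat \<Rightarrow> real \<Rightarrow> real" where
  "cheb_T 0 x = 1"
| "cheb_T (Suc 0) x = x"
| "cheb_T (Suc (Suc n)) x = 2 * x * cheb_T (Suc n) x - cheb_T n x"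

fun cheb_U :: "nat \<Rightarrow> real \<Rightarrow> real" where
  "cheb_U 0 x = 1"
| "cheb_U (Suc 0) x = 2 * x"
| "cheb_U (Suc (Suc n)) x = 2 * x * cheb_U (Suc n) x - cheb_U n x"

text \<open>The iterates of HB_2(h0,h1;m) started at x0, for a gradient map g.\<close>
fun hb2 :: "real \<Rightarrow> real \<Rightarrow> real \<Rightarrow> ('a::real_vector \<Rightarrow> 'a) \<Rightarrow> 'a \<Rightarrow> nat \<Rightarrow> 'a" where
  "hb2 h0 h1 m g x0 0 = x0"
| "hb2 h0 h1 m g x0 (Suc 0) = x0 - (h0 / (1 + m)) *\<^sub>R g x0"
| "hb2 h0 h1 m g x0 (Suc (Suc t)) =
     hb2 h0 h1 m g x0 (Suc t)
     - (if even (Suc t) then h0 else h1) *\<^sub>R g (hb2 h0 h1 m g x0 (Suc t))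
     + m *\<^sub>R (hb2 h0 h1 m g x0 (Suc t) - hb2 h0 h1 m g x0 t)"

text \<open>Evaluation of a real polynomial at a square matrix.\<close>
definition poly_mat :: "real poly \<Rightarrow> real^'n^'n \<Rightarrow> real^'n^'n" where
  "poly_mat p H = (\<Sum>i\<le>degree p. coeff p i *\<^sub>R (((\<lambda>A. H ** A) ^^ i) (mat 1)))"

end

theory Submission
  imports Defs
begin

(*
  Taking H = lam * I and x_* = 0 shows that P_t(lam) satisfies the scalar recursion of
  HB_2 itself.  Eliminating the odd-indexed terms gives the recursion
  P_(2k+4) = ((1 + m - lam h0)(1 + m - lam h1) - 2m) P_(2k+2) - m^2 P_(2k), whose
  coefficient equals 4 m z^2 - 2m with z = sqrt(zeta(lam)).  Since T_(2k)(z) and U_(2k)(z)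
  obey Q_(2k+4) = 2 (2 z^2 - 1) Q_(2k+2) - Q_(2k), the right-hand side satisfies the same
  second-order recursion and agrees with P_0 and P_2, hence with every P_(2n).
*)

fun hb2_residual :: "real \<Rightarrow> real \<Rightarrow> real \<Rightarrow> real \<Rightarrow> nat \<Rightarrow> real" where
  "hb2_residual h0 h1 m lam 0 = 1"
| "hb2_residual h0 h1 m lam (Suc 0) = 1 - h0 / (1 + m) * lam"
| "hb2_residual h0 h1 m lam (Suc (Suc t)) =
     (1 + m - (if even (Suc t) then h0 else h1) * lam) * hb2_residual h0 h1 m lam (Suc t)
     - m * hb2_residual h0 h1 m lam t"

lemma hb2_scaleR:
  "hb2 h0 h1 m ((*\<^sub>R) lam) x0 t = hb2_residual h0 h1 m lam t *\<^sub>R x0"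
  by (induction h0 h1 m lam t rule: hb2_residual.induct) (simp_all add: algebra_simps)

lemma mat_eq_scaleR: "(mat a :: real^'n^'n) = a *\<^sub>R mat 1"
  by (simp add: mat_def vec_eq_iff)

lemma mat_matrix_mul: "(mat a :: real^'n^'n) ** A = a *\<^sub>R A"
  unfolding mat_eq_scaleR[of a] scalar_matrix_assoc[symmetric] by simp

lemma mat_matrix_vector_mul: "(mat a :: real^'n^'n) *v x = a *\<^sub>R x"
  unfolding mat_eq_scaleR[of a] scaleR_matrix_vector_assoc[symmetric] by simp

lemma poly_mat_mat: "poly_mat p (mat a :: real^'n^'n) = mat (poly p a)"
proof -
  have "((\<lambda>A. (mat a :: real^'n^'n) ** A) ^^ i) (mat 1) = a ^ i *\<^sub>R mat 1" for i
    by (induction i) (simp_all add: mat_matrix_mul)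
  then have "poly_mat p (mat a :: real^'n^'n) = (\<Sum>i\<le>degree p. coeff p i * a ^ i) *\<^sub>R mat 1"
    by (simp add: poly_mat_def scaleR_sum_left)
  then show ?thesis
    by (simp add: poly_altdef flip: mat_eq_scaleR)
qed

lemma hb2_residual_even_step:
  "hb2_residual h0 h1 m lam (Suc (Suc (Suc (Suc (2 * k))))) =
     ((1 + m - lam * h0) * (1 + m - lam * h1) - 2 * m) * hb2_residual h0 h1 m lam (Suc (Suc (2 * k)))
     - m\<^sup>2 * hb2_residual h0 h1 m lam (2 * k)"
  by simp (simp add: algebra_simps power2_eq_square)

lemma chebyshev_recurrence_step2:
  fixes Q :: "nat \<Rightarrow> 'a::comm_ring_1"
  assumes rec: "\<And>n. Q (Suc (Suc n)) = 2 * x * Q (Suc n) - Q n"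
  shows "Q (Suc (Suc (Suc (Suc n)))) = 2 * (2 * x\<^sup>2 - 1) * Q (Suc (Suc n)) - Q n"
  by (simp add: rec algebra_simps power2_eq_square)

lemma linear_recurrence_unique:
  fixes a b :: "nat \<Rightarrow> 'a::comm_semiring"
  assumes "\<And>k. a (Suc (Suc k)) = p * a (Suc k) + q * a k"
    and "\<And>k. b (Suc (Suc k)) = p * b (Suc k) + q * b k"
    and "a 0 = b 0" "a 1 = b 1"
  shows "a k = b k"
proof -
  have "a k = b k \<and> a (Suc k) = b (Suc k)"
    by (induction k) (simp_all add: assms(1,2) assms(3,4)[unfolded One_nat_def])
  then show ?thesis ..
qed

lemma hb2_residual_even_chebyshev:
  assumes m: "1 + m \<noteq> 0"
    and zeta: "(1 + m - lam * h0) * (1 + m - lam * h1) = 4 * m * z\<^sup>2"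
  shows "hb2_residual h0 h1 m lam (2 * n) =
    m ^ n * (2 * m / (1 + m) * cheb_T (2 * n) z + (1 - m) / (1 + m) * cheb_U (2 * n) z)"
proof -
  let ?a = "\<lambda>k. hb2_residual h0 h1 m lam (2 * k)"
  let ?b = "\<lambda>k. m ^ k * (2 * m / (1 + m) * cheb_T (2 * k) z + (1 - m) / (1 + m) * cheb_U (2 * k) z)"
  let ?p = "4 * m * z\<^sup>2 - 2 * m"
  have a_rec: "?a (Suc (Suc k)) = ?p * ?a (Suc k) + - m\<^sup>2 * ?a k" for k
    using hb2_residual_even_step[of h0 h1 m lam k] by (simp add: zeta)
  have b_rec: "?b (Suc (Suc k)) = ?p * ?b (Suc k) + - m\<^sup>2 * ?b k" for k
  proof -
    \<comment> \<open>stated for opaque values so that the simplifier cannot unfold cheb_T and cheb_U\<close>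
    have combine: "m ^ Suc (Suc k) * (A * T2 + B * U2) =
        ?p * (m ^ Suc k * (A * T1 + B * U1)) + - m\<^sup>2 * (m ^ k * (A * T0 + B * U0))"
      if "T2 = 2 * (2 * z\<^sup>2 - 1) * T1 - T0" "U2 = 2 * (2 * z\<^sup>2 - 1) * U1 - U0"
      for A B T0 T1 T2 U0 U1 U2 :: real
      unfolding that by (simp add: algebra_simps power2_eq_square)
    have T: "cheb_T (2 * Suc (Suc k)) z =
        2 * (2 * z\<^sup>2 - 1) * cheb_T (2 * Suc k) z - cheb_T (2 * k) z"
      using chebyshev_recurrence_step2[of "\<lambda>n. cheb_T n z" z "2 * k"] by simp
    have U: "cheb_U (2 * Suc (Suc k)) z =
        2 * (2 * z\<^sup>2 - 1) * cheb_U (2 * Suc k) z - cheb_U (2 * k) z"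
      using chebyshev_recurrence_step2[of "\<lambda>n. cheb_U n z" z "2 * k"] by simp
    show ?thesis
      by (rule combine[OF T U])
  qed
  have a0: "?a 0 = ?b 0"
    using m by (simp add: add_divide_distrib[symmetric])
  have a1: "?a 1 = ?b 1"
  proof -
    have "?a 1 = (1 + m - lam * h0) * (1 + m - lam * h1) / (1 + m) - m"
      using m by (simp add: numeral_eq_Suc field_simps)
    also have "\<dots> = m * ((2 * m * (2 * z\<^sup>2 - 1) + (1 - m) * (4 * z\<^sup>2 - 1)) / (1 + m))"
      unfolding zeta using m by (simp add: field_simps)
    also have "\<dots> = ?b 1"
      by (simp add: add_divide_distrib numeral_eq_Suc power2_eq_square)
    finally show ?thesis .
  qed
  show ?thesis
    by (rule linear_recurrence_unique[of ?a ?p "- m\<^sup>2" ?b, OF a_rec b_rec a0 a1])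
qed

theorem mainTheorem14:
  fixes m h0 h1 :: real
    and P :: "nat \<Rightarrow> real poly"
    and lam :: real and n :: nat
  assumes m: "0 < m" "m < 1"
    and residual: "\<And>(H::real^'d^'d) (xs::real^'d) x0 t.
        transpose H = H \<Longrightarrow>
        hb2 h0 h1 m (\<lambda>x. H *v (x - xs)) x0 t - xs = poly_mat (P t) H *v (x0 - xs)"
    and zeta: "((1 + m - lam * h0) / (2 * sqrt m)) * ((1 + m - lam * h1) / (2 * sqrt m)) \<ge> 0"
  shows "poly (P (2 * n)) lam =
    m ^ n * (2 * m / (1 + m) * cheb_T (2 * n)
               (sqrt (((1 + m - lam * h0) / (2 * sqrt m)) * ((1 + m - lam * h1) / (2 * sqrt m))))
           + (1 - m) / (1 + m) * cheb_U (2 * n)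
               (sqrt (((1 + m - lam * h0) / (2 * sqrt m)) * ((1 + m - lam * h1) / (2 * sqrt m)))))"
proof -
  define z where "z = sqrt (((1 + m - lam * h0) / (2 * sqrt m)) * ((1 + m - lam * h1) / (2 * sqrt m)))"
  have "z\<^sup>2 = (1 + m - lam * h0) * (1 + m - lam * h1) / (4 * m)"
    using zeta m by (simp add: z_def field_simps)
  then have zeta_sq: "(1 + m - lam * h0) * (1 + m - lam * h1) = 4 * m * z\<^sup>2"
    using m by (simp add: field_simps)
  have scalar_gradient: "(\<lambda>x. (mat lam :: real^'d^'d) *v (x - 0)) = (*\<^sub>R) lam"
    by (simp add: fun_eq_iff mat_matrix_vector_mul)
  have "hb2 h0 h1 m (\<lambda>x. (mat lam :: real^'d^'d) *v (x - 0)) 1 (2 * n) - 0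
      = poly_mat (P (2 * n)) (mat lam) *v (1 - 0)"
    by (rule residual) simp
  then have "hb2_residual h0 h1 m lam (2 * n) *\<^sub>R (1 :: real^'d) = poly (P (2 * n)) lam *\<^sub>R 1"
    by (simp only: scalar_gradient hb2_scaleR poly_mat_mat mat_matrix_vector_mul diff_zero)
  then have "hb2_residual h0 h1 m lam (2 * n) = poly (P (2 * n)) lam"
    by (simp add: vec_eq_iff)
  with hb2_residual_even_chebyshev[OF _ zeta_sq] show ?thesis
    using m by (simp add: z_def)
qed

end
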